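(* Let $\{Q_p(x)\}_{p\ge0}$ be a sequence of orthogonal polynomials satisfying $Q_{p+1}(x)=S_p(x)Q_p(x)-C_pQ_{p-1}(x)$ for all $p\ge1$, where $S_p(x)=A_px+B_p$ and the Favard coefficients $A_p,B_p,C_p$ are as in the context. Then for all integers $p\ge1$ and $s\ge1$ (and all real $x$), $$Q_{p+s}(x)=\Psi_{p+s}^{(p)}(x)Q_p(x)+\Psi_{p+s}^{(p-1)}(x)Q_{p-1}(x),$$ where the coefficients are determined by $\Psi_{p+1}^{(p)}(x)=S_p(x)$, $\Psi_{p+1}^{(p-1)}(x)=-C_p$, $\Psi_{p+2}^{(p)}(x)=S_{p+1}(x)S_p(x)-C_{p+1}$, $\Psi_{p+2}^{(p-1)}(x)=-C_pS_{p+1}(x)$, and, for $s\ge3$, $$\begin{bmatrix}\Psi_{p+s}^{(p)}(x)\\ \Psi_{p+s}^{(p-1)}(x)\end{bmatrix}=\begin{bmatrix}\Psi_{p+s-1}^{(p)}(x)&\Psi_{p+s-2}^{(p)}(x)\\ \Psi_{p+s-1}^{(p-1)}(x)&\Psi_{p+s-2}^{(p-1)}(x)\end{bmatrix}\begin{bmatrix}S_{p+s-1}(x)\\-C_{p+s-1}\end{bmatrix}.$$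
   Context: The sequence is given by Favard's recurrence $Q_{p+1}(x)=(A_px+B_p)Q_p(x)-C_pQ_{p-1}(x)$ for $p\ge0$, with $Q_0(x)=1$, $Q_{-1}(x)=0$, where $(A_p),(B_p),(C_p)$ are real sequences with $A_p\ne0$ for all $p\ge 0$, and $C_p\neq 0$ and $C_pA_pA_{p-1}>0$ for all $p\ge 1$ ($C_0$ is irrelevant since $Q_{-1}=0$). *)

theory Defs
  imports "HOL-Analysis.Analysis" "HOL-Computational_Algebra.Polynomial"
begin

(* M is a positive Borel measure on the real line with finite moments. *)
definition orthogonal_polynomials :: "real measure \<Rightarrow> (nat \<Rightarrow> real poly) \<Rightarrow> bool" where
  "orthogonal_polynomials M Q \<longleftrightarrow>
     sets M = sets borel \<and>
     (\<forall>k. integrable M (\<lambda>x. x ^ k)) \<and>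
     (\<forall>n. degree (Q n) = n) \<and>
     (\<forall>m n. m \<noteq> n \<longrightarrow> (LINT x|M. poly (Q m) x * poly (Q n) x) = 0) \<and>
     (\<forall>n. (LINT x|M. (poly (Q n) x)\<^sup>2) > 0)"

definition favard_S :: "(nat \<Rightarrow> real) \<Rightarrow> (nat \<Rightarrow> real) \<Rightarrow> nat \<Rightarrow> real \<Rightarrow> real" where
  "favard_S A B p x = A p * x + B p"

(* Psi S C p s x is the column vector with entries Psi_{p+s}^{(p)}(x) and Psi_{p+s}^{(p-1)}(x).
   The base index p is an explicit argument because the superscript alone does not determine the
   coefficient: for instance, Psi_{p+2}^{(p)} is S_{p+1} S_p - C_{p+1} in the expansion with base p,
   but -C_{p+1} in the expansion with base p+1. The value at s = 0 is a convention; the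
   recursion for s >= 3 never reaches it. *)
fun Psi :: "(nat \<Rightarrow> real \<Rightarrow> real) \<Rightarrow> (nat \<Rightarrow> real) \<Rightarrow> nat \<Rightarrow> nat \<Rightarrow> real \<Rightarrow> real ^ 2" where
  "Psi S C p 0 x = vector [1, 0]"
| "Psi S C p (Suc 0) x = vector [S p x, - C p]"
| "Psi S C p (Suc (Suc 0)) x =
     vector [S (p + 1) x * S p x - C (p + 1), - C p * S (p + 1) x]"
| "Psi S C p (Suc (Suc (Suc s))) x =
     (vector
        [vector [Psi S C p (Suc (Suc s)) x $ 1, Psi S C p (Suc s) x $ 1],
         vector [Psi S C p (Suc (Suc s)) x $ 2, Psi S C p (Suc s) x $ 2]] :: real ^ 2 ^ 2)
     *v vector [S (p + s + 2) x, - C (p + s + 2)]"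

end

theory Submission
  imports Defs
begin

text \<open>
  The values \<^term>\<open>y n = poly (Q n) x\<close> satisfy a linear three-term recurrence
  whose solution space is two-dimensional, so every later value is a linear combination of
  \<^term>\<open>y p\<close> and \<^term>\<open>y (p - 1)\<close>. Applying the recurrence to the
  index \<^term>\<open>p + s\<close> and expanding both terms on its right-hand side shows that each
  of the two coefficients, as a function of \<^term>\<open>s\<close>, obeys the same recurrence
  shifted by \<^term>\<open>p\<close>. The matrix recursion defining \<^const>\<open>Psi\<close> is
  exactly this recurrence (lemma \<open>Psi_three_term\<close>), so the claim follows by two-step
  induction on \<^term>\<open>s\<close> (lemma \<open>three_term_expansion\<close>).
\<close>

text \<open>
  The matrix product is a linear combination of the columns of the matrix, which are the two
  preceding coefficient vectors. The convention that the vector at \<open>s = 0\<close> is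
  \<open>(1, 0)\<close>, which expresses the trivial expansion of \<open>y p\<close> itself, makes the
  explicit vector at \<open>s = 2\<close> an instance of the same rule, so a single recurrence
  covers all indices.
\<close>

lemma Psi_three_term:
  "Psi S C p (Suc (Suc s)) x $ i =
     S (p + s + 1) x * Psi S C p (Suc s) x $ i - C (p + s + 1) * Psi S C p s x $ i"
proof (cases s)
  case 0
  then show ?thesis
    using exhaust_2[of i] by (auto simp: vector_2)
next
  case (Suc t)
  then show ?thesis
    using exhaust_2[of i]
    by (auto simp: matrix_vector_mult_def sum_2 vector_2 algebra_simps)
qed

text \<open>
  Both sides, as functions of \<open>s\<close>, solve the recurrence shifted by \<open>p\<close>, and
  they agree for \<open>s = 0\<close> (by the convention for the coefficients there) and for
  \<open>s = 1\<close> (by the recurrence at the index \<open>p\<close>).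
\<close>

lemma three_term_expansion:
  fixes y :: "nat \<Rightarrow> real"
  assumes rec: "\<And>n. n \<ge> 1 \<Longrightarrow> y (n + 1) = S n x * y n - C n * y (n - 1)"
    and p: "p \<ge> 1"
  shows "y (p + s) = Psi S C p s x $ 1 * y p + Psi S C p s x $ 2 * y (p - 1)"
proof (induction s rule: induct_nat_012)
  case 0
  show ?case by (simp add: vector_2)
next
  case 1
  show ?case using rec[OF p] by (simp add: vector_2)
next
  case (ge2 s)
  have "y (p + Suc (Suc s)) = S (p + s + 1) x * y (p + Suc s) - C (p + s + 1) * y (p + s)"
    using rec[of "p + s + 1"] by simp
  then show ?case
    unfolding ge2.IH Psi_three_term by (simp add: algebra_simps)
qed

theorem theorem2:
  fixes A B C :: "nat \<Rightarrow> real"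
    and Q :: "nat \<Rightarrow> real poly"
    and M :: "real measure"
    and p s :: nat
    and x :: real
  assumes A_nonzero: "\<And>n. A n \<noteq> 0"
    and C_nonzero: "\<And>n. n \<ge> 1 \<Longrightarrow> C n \<noteq> 0"
    and CAA_pos: "\<And>n. n \<ge> 1 \<Longrightarrow> C n * A n * A (n - 1) > 0"
    and orthogonal: "orthogonal_polynomials M Q"
    and Q_0: "Q 0 = 1"
    and Q_1: "\<And>y. poly (Q 1) y = favard_S A B 0 y"
    and Q_rec: "\<And>n y. n \<ge> 1 \<Longrightarrow>
      poly (Q (n + 1)) y = favard_S A B n y * poly (Q n) y - C n * poly (Q (n - 1)) y"
    and "p \<ge> 1" and "s \<ge> 1"
  shows "poly (Q (p + s)) x =
    Psi (favard_S A B) C p s x $ 1 * poly (Q p) x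
    + Psi (favard_S A B) C p s x $ 2 * poly (Q (p - 1)) x"
  using Q_rec \<open>p \<ge> 1\<close> by (rule three_term_expansion)

end
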